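(* Let $D=(V,A)$ be a complete acyclic digraph with $|V|=n\geq 1$. Then the NL-flow polynomial of $D$ is given by $$\phi_{NL}^D(x)=\sum_{p=1}^n(-1)^{p-1}\sum_{(k_1,\dots,k_p)}\ \prod_{i=1}^p x^{\binom{k_i-1}{2}},$$ where the inner sum runs over all compositions $(k_1,\dots,k_p)$ of $n$ into $p$ parts, i.e. all $p$-tuples of integers $k_i\ge1$ with $\sum_{i=1}^p k_i=n$.
   Context: A complete acyclic digraph is an acyclic orientation of a complete graph (exactly one arc between any two distinct vertices, no directed cycle). Here $\binom{0}{2}=\binom{1}{2}=0$. A directed cut of $D=(V,A)$ is a nonempty set of arcs consisting of all arcs with tail in $X$ and head in $V\setminus X$, for some $X\subseteq V$ such that no arc has tail in $V\setminus X$ and head in $X$. Let $\mathcal{C}=\{A\setminus C : C \text{ is a (possibly empty) union of directed cuts of } D\}$, partially ordered by $\supseteq$ (so $B\le B'$ iff $B\supseteq B'$). The Möbius function $\mu$ of a finite poset is defined by $\mu(x,y)=0$ if $x\not\le y$, $\mu(x,x)=1$, and $\mu(x,y)=-\sum_{x\le z<y}\mu(x,z)$ if $x<y$. For $B\subseteq A$, $rk(B)$ is $|V|$ minus the number of connected components of $(V,B)$. The NL-flow polynomial of $D$ is $\phi_{NL}^D(x)=\sum_{B\in\mathcal{C}}\mu(A,B)\,x^{|B|-rk(B)}$, with $\mu$ the Möbius function of $(\mathcal{C},\supseteq)$. *)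

theory Defs
  imports
    "Graph_Theory.Digraph_Component"
    "HOL-Computational_Algebra.Polynomial"
begin

section \<open>Moebius function of a finite poset\<close>

text \<open>A poset is given by its order relation \<open>r\<close>, with carrier \<^term>\<open>Field r\<close>. The function is
  set to 0 if \<open>r\<close> is not a finite partial order.\<close>

function moebius :: "'p rel \<Rightarrow> 'p \<Rightarrow> 'p \<Rightarrow> int" where
  "moebius r x y =
    (if finite r \<and> Partial_order r \<and> (x, y) \<in> r
     then if x = y then 1
          else - (\<Sum>z | (x, z) \<in> r \<and> (z, y) \<in> r \<and> z \<noteq> y. moebius r x z)
     else 0)"
  by pat_completeness auto
termination
proof (relation "measure (\<lambda>(r, x, y). card {w. (w, y) \<in> r})")
  show "wf (measure (\<lambda>(r :: 'p rel, x :: 'p, y). card {w. (w, y) \<in> r}))"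
    by simp
next
  fix r :: "'p rel" and x y z
  assume r: "finite r \<and> Partial_order r \<and> (x, y) \<in> r"
    and "z \<in> {z. (x, z) \<in> r \<and> (z, y) \<in> r \<and> z \<noteq> y}"
  then have z: "(z, y) \<in> r" "z \<noteq> y" by auto
  from r have "trans r" "antisym r" "refl_on (Field r) r"
    by (auto simp: partial_order_on_def preorder_on_def)
  moreover have "y \<in> Field r" using z by (auto simp: Field_def)
  ultimately have "(y, y) \<in> r" "(y, z) \<notin> r" "{w. (w, z) \<in> r} \<subseteq> {w. (w, y) \<in> r}"
    using z by (auto dest: antisymD refl_onD transD)
  then have "{w. (w, z) \<in> r} \<subset> {w. (w, y) \<in> r}" by blast
  moreover have "finite {w. (w, y) \<in> r}"
    by (rule finite_subset[of _ "fst ` r"]) (use r in \<open>auto intro: rev_image_eqI\<close>)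
  ultimately show "((r, x, z), (r, x, y)) \<in> measure (\<lambda>(r, x, y). card {w. (w, y) \<in> r})"
    by (simp add: psubset_card_mono)
qed

declare moebius.simps [simp del]

lemma moebius_not_le: "(x, y) \<notin> r \<Longrightarrow> moebius r x y = 0"
  by (subst moebius.simps) simp

lemma moebius_refl: "finite r \<Longrightarrow> Partial_order r \<Longrightarrow> x \<in> Field r \<Longrightarrow> moebius r x x = 1"
  by (subst moebius.simps) (auto simp: partial_order_on_def preorder_on_def dest: refl_onD)

lemma moebius_less:
  "finite r \<Longrightarrow> Partial_order r \<Longrightarrow> (x, y) \<in> r \<Longrightarrow> x \<noteq> y \<Longrightarrow>
    moebius r x y = - (\<Sum>z | (x, z) \<in> r \<and> (z, y) \<in> r \<and> z \<noteq> y. moebius r x z)"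
  by (subst moebius.simps) simp


section \<open>The NL-flow polynomial\<close>

definition directed_cut :: "('a, 'b) pre_digraph \<Rightarrow> 'b set \<Rightarrow> bool" where
  "directed_cut D C \<longleftrightarrow> C \<noteq> {} \<and>
    (\<exists>X \<subseteq> verts D. C = {e \<in> arcs D. tail D e \<in> X \<and> head D e \<in> verts D - X} \<and>
      \<not> (\<exists>e \<in> arcs D. tail D e \<in> verts D - X \<and> head D e \<in> X))"

definition cut_complements :: "('a, 'b) pre_digraph \<Rightarrow> 'b set set" where
  "cut_complements D = {arcs D - \<Union>F | F. \<forall>C \<in> F. directed_cut D C}"

definition cut_complements_order :: "('a, 'b) pre_digraph \<Rightarrow> 'b set rel" where
  "cut_complements_order D =
    {(B, B'). B \<in> cut_complements D \<and> B' \<in> cut_complements D \<and> B \<supseteq> B'}"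

definition num_components :: "('a, 'b) pre_digraph \<Rightarrow> nat" where
  "num_components D = card {H. pre_digraph.max_subgraph D connected H}"

definition rk :: "('a, 'b) pre_digraph \<Rightarrow> 'b set \<Rightarrow> nat" where
  "rk D B = card (verts D) - num_components (D\<lparr>arcs := B\<rparr>)"

text \<open>In a finite digraph with \<open>B \<subseteq> arcs D\<close>, neither of the natural-number subtractions (in \<^const>\<open>rk\<close> and in the
  exponent below) truncates, as \<open>card (verts D) \<le> num_components (D\<lparr>arcs := B\<rparr>) + card B\<close> and
  \<open>num_components (D\<lparr>arcs := B\<rparr>) \<le> card (verts D)\<close>.\<close>

definition nl_flow_poly :: "('a, 'b) pre_digraph \<Rightarrow> int poly" where
  "nl_flow_poly D = (\<Sum>B \<in> cut_complements D.
    monom (moebius (cut_complements_order D) (arcs D) B) (card B - rk D B))"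

lemma Field_cut_complements_order: "Field (cut_complements_order D) = cut_complements D"
  by (auto simp: Field_def cut_complements_order_def)

lemma Partial_order_cut_complements_order: "Partial_order (cut_complements_order D)"
  unfolding partial_order_on_def preorder_on_def Field_cut_complements_order
  by (auto simp: cut_complements_order_def refl_on_def trans_def antisym_def)

lemma finite_cut_complements_order:
  assumes "finite (arcs D)"
  shows "finite (cut_complements_order D)"
proof (rule finite_subset)
  show "cut_complements_order D \<subseteq> Pow (arcs D) \<times> Pow (arcs D)"
    by (auto simp: cut_complements_order_def cut_complements_def)
qed (use assms in simp)


section \<open>Complete acyclic digraphs and compositions\<close>

locale complete_acyclic_digraph = digraph D for D :: "('a, 'b) pre_digraph" +
  assumes complete: "\<And>u v. u \<in> verts D \<Longrightarrow> v \<in> verts D \<Longrightarrow> u \<noteq> v \<Longrightarrow>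
      \<exists>!e. e \<in> arcs D \<and> {tail D e, head D e} = {u, v}"
    and no_directed_cycle: "\<not> (\<exists>p. pre_digraph.cycle D p)"

definition compositions :: "nat \<Rightarrow> nat \<Rightarrow> nat list set" where
  "compositions n p = {ks. length ks = p \<and> sum_list ks = n \<and> (\<forall>k \<in> set ks. k \<ge> 1)}"

end

theory Submission
  imports Defs
begin

text \<open>A complete acyclic digraph is a transitive tournament, so its vertices are numbered
  \<open>0, \<dots>, n - 1\<close> by in-degree. The directed cuts are the sets of arcs jumping over a
  threshold \<open>t\<close> with \<open>1 \<le> t < n\<close>, hence the cut complements form the Boolean lattice of
  all sets \<open>S\<close> of thresholds and the Moebius function is \<open>(-1) ^ card S\<close>. The thresholds in \<open>S\<close>
  split the vertices into \<open>card S + 1\<close> intervals whose lengths form a composition of \<open>n\<close>, and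
  the complement is the disjoint union of the tournaments on these intervals; an interval of
  length \<open>k\<close> contributes \<open>(k choose 2) - (k - 1) = (k - 1) choose 2\<close> to the exponent.\<close>

section \<open>Moebius function of a Boolean lattice\<close>

text \<open>Expanding the product of the factors \<open>-1 + 1\<close> over \<open>S\<close> gives
  one signed term for each subset of \<open>S\<close>.\<close>

lemma sum_Pow_minus_one_power_card:
  assumes "finite S" "S \<noteq> {}"
  shows "(\<Sum>T\<in>Pow S. (-1) ^ card T) = (0 :: int)"
  using prod_add[OF assms(1), of "\<lambda>_. -1 :: int" "\<lambda>_. 1"] assms by (auto simp: power_0_left)

text \<open>The map \<open>\<beta>\<close> is kept abstract so that it may reverse inclusion, as
  taking complements of unions of cuts does. By induction, the recursion for the Moebius function
  becomes an alternating sum over proper subsets.\<close>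

lemma moebius_Boolean_lattice:
  assumes r: "finite r" "Partial_order r"
    and N: "finite N" "Field r = \<beta> ` Pow N"
    and iff: "\<And>S T. S \<subseteq> N \<Longrightarrow> T \<subseteq> N \<Longrightarrow> (\<beta> S, \<beta> T) \<in> r \<longleftrightarrow> S \<subseteq> T"
    and "S \<subseteq> N"
  shows "moebius r (\<beta> {}) (\<beta> S) = (-1) ^ card S"
proof -
  have eq_iff: "\<beta> S = \<beta> T \<longleftrightarrow> S = T" if "S \<subseteq> N" "T \<subseteq> N" for S T
    using iff that by (metis subset_antisym subset_refl)
  have "finite S"
    using assms finite_subset by blast
  then show ?thesis
    using \<open>S \<subseteq> N\<close>
  proof (induction S rule: finite_psubset_induct)
    case (psubset S)
    show ?case
    proof (cases "S = {}")
      case True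
      then show ?thesis
        using r N by (simp add: moebius_refl)
    next
      case False
      have below: "{z. (\<beta> {}, z) \<in> r \<and> (z, \<beta> S) \<in> r \<and> z \<noteq> \<beta> S} = \<beta> ` (Pow S - {S})"
      proof (intro set_eqI iffI)
        fix z assume z: "z \<in> {z. (\<beta> {}, z) \<in> r \<and> (z, \<beta> S) \<in> r \<and> z \<noteq> \<beta> S}"
        then have "z \<in> Field r"
          by (auto simp: Field_def)
        then obtain T where "T \<subseteq> N" "z = \<beta> T"
          using N by auto
        then show "z \<in> \<beta> ` (Pow S - {S})"
          using z iff psubset.prems by auto
      next
        fix z assume "z \<in> \<beta> ` (Pow S - {S})"
        then obtain T where T: "T \<subseteq> S" "T \<noteq> S" "z = \<beta> T"
          by auto
        moreover from T have "T \<subseteq> N"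
          using psubset.prems by blast
        ultimately show "z \<in> {z. (\<beta> {}, z) \<in> r \<and> (z, \<beta> S) \<in> r \<and> z \<noteq> \<beta> S}"
          using iff eq_iff psubset.prems by auto
      qed
      have inj: "inj_on \<beta> (Pow S - {S})"
        using eq_iff psubset.prems by (auto intro!: inj_onI)
      have "moebius r (\<beta> {}) (\<beta> S) = - (\<Sum>z\<in>\<beta> ` (Pow S - {S}). moebius r (\<beta> {}) z)"
        using moebius_less[OF r, of "\<beta> {}" "\<beta> S"] iff[of "{}" S] eq_iff[of "{}" S] psubset.prems
          False below by simp
      also have "\<dots> = - (\<Sum>T\<in>Pow S - {S}. moebius r (\<beta> {}) (\<beta> T))"
        by (simp add: sum.reindex[OF inj])
      also have "\<dots> = - (\<Sum>T\<in>Pow S - {S}. (-1) ^ card T)"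
      proof -
        have "moebius r (\<beta> {}) (\<beta> T) = (-1) ^ card T" if "T \<in> Pow S - {S}" for T
          using psubset.IH[of T] psubset.prems that by blast
        then show ?thesis by simp
      qed
      \<comment> \<open>The alternating sum over all of \<open>Pow S\<close> vanishes, so what is
        left without \<open>S\<close> is minus the term of \<open>S\<close>.\<close>
      also have "\<dots> = (-1) ^ card S"
        using sum_Pow_minus_one_power_card[OF psubset.hyps(1) False] psubset.hyps(1)
        by (simp add: sum_diff1)
      finally show ?thesis .
    qed
  qed
qed


section \<open>Components of a disjoint union of tournaments\<close>

text \<open>Connectedness is reachability in the symmetric closure, and a label preserved by every
  arc is preserved along arcs in both directions.\<close>

lemma connected_imp_fibre:
  assumes "connected H"
    and const: "\<And>e. e \<in> arcs H \<Longrightarrow> c (tail H e) = c (head H e)"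
    and "u \<in> verts H" "v \<in> verts H"
  shows "c u = c v"
proof -
  have "(u, v) \<in> rtrancl_on (verts H) (arcs_ends (mk_symmetric H))"
    using assms by (auto simp: connected_def strongly_connected_def reachable_def)
  then show ?thesis
    by (induction rule: rtrancl_on_induct)
      (use const in \<open>auto simp: arcs_ends_conv parcs_mk_symmetric\<close>)
qed

text \<open>The components are the subgraphs induced on the fibres of \<open>c\<close>: a fibre is
  connected because any two of its vertices are adjacent, and no connected subgraph meets two
  fibres.\<close>

lemma num_components_eq_card_fibres:
  assumes "wf_digraph G"
    and const: "\<And>e. e \<in> arcs G \<Longrightarrow> c (tail G e) = c (head G e)"
    and adjacent: "\<And>u v. u \<in> verts G \<Longrightarrow> v \<in> verts G \<Longrightarrow> u \<noteq> v \<Longrightarrow> c u = c v \<Longrightarrow>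
      \<exists>e\<in>arcs G. {tail G e, head G e} = {u, v}"
  shows "num_components G = card (c ` verts G)"
proof -
  interpret wf_digraph G by fact
  define V where "V i = {v \<in> verts G. c v = i}" for i
  have sub: "subgraph (G \<restriction> V i) G" for i
    by (rule subgraph_induce_subgraphI) (auto simp: V_def)
  have conn: "connected (G \<restriction> V i)" if i: "i \<in> c ` verts G" for i
    unfolding connected_def
  proof
    show "verts (with_proj (mk_symmetric (G \<restriction> V i))) \<noteq> {}"
      using i by (auto simp: V_def)
    fix u v assume uv: "u \<in> verts (with_proj (mk_symmetric (G \<restriction> V i)))"
      "v \<in> verts (with_proj (mk_symmetric (G \<restriction> V i)))"
    show "u \<rightarrow>\<^sup>*\<^bsub>with_proj (mk_symmetric (G \<restriction> V i))\<^esub> v"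
    proof (cases "u = v")
      case True
      then show ?thesis using uv by (auto simp: reachable_def)
    next
      case False
      then obtain e where "e \<in> arcs G" "{tail G e, head G e} = {u, v}"
        using adjacent[of u v] uv by (auto simp: V_def)
      then have "(u, v) \<in> parcs (mk_symmetric (G \<restriction> V i))"
        using uv by (auto simp: parcs_mk_symmetric doubleton_eq_iff)
      then show ?thesis
        using uv unfolding reachable_def
        by (intro rtrancl_on_into_rtrancl_on[OF rtrancl_on.rtrancl_on_refl]) auto
    qed
  qed
  have fibre: "\<exists>i\<in>c ` verts G. verts H \<subseteq> V i" if H: "subgraph H G" "connected H" for H
  proof -
    have "\<And>e. e \<in> arcs H \<Longrightarrow> c (tail H e) = c (head H e)"
      using H(1) const by (auto simp: subgraph_def compatible_def)
    from connected_imp_fibre[of H c, OF H(2) this]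
    have *: "\<And>u v. u \<in> verts H \<Longrightarrow> v \<in> verts H \<Longrightarrow> c u = c v" .
    have "verts H \<noteq> {}"
      using H(2) by (simp add: connected_def strongly_connected_def)
    then obtain w where w: "w \<in> verts H"
      by blast
    have "verts H \<subseteq> verts G"
      using H(1) by (simp add: subgraph_def)
    then have "verts H \<subseteq> V (c w)" "w \<in> verts G"
      using * w unfolding V_def by blast+
    then show ?thesis
      by blast
  qed
  have maximal: "H = G \<restriction> V i"
    if H: "subgraph H G" "connected H" "subgraph (G \<restriction> V i) H" "i \<in> c ` verts G" for H i
  proof -
    obtain j where j: "verts H \<subseteq> V j"
      using fibre H by blast
    have "V i \<subseteq> verts H"
      using H(3) by (simp add: subgraph_def)
    \<comment> \<open>The fibre \<open>V i\<close> is nonempty and lies in \<open>V j\<close>, and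
      distinct fibres are disjoint.\<close>
    moreover from this have "i = j"
      using j H(4) by (auto simp: V_def)
    ultimately have "verts H = V i"
      using j by blast
    moreover have "arcs H = arcs (G \<restriction> V i)"
    proof
      show "arcs H \<subseteq> arcs (G \<restriction> V i)"
        using H(1) \<open>verts H = V i\<close> wf_digraph.tail_in_verts[of H] wf_digraph.head_in_verts[of H]
        unfolding subgraph_def compatible_def by fastforce
      show "arcs (G \<restriction> V i) \<subseteq> arcs H"
        using H(3) unfolding subgraph_def by blast
    qed
    ultimately show ?thesis
      using H(1) by (auto simp: induce_subgraph_def subgraph_def compatible_def)
  qed
  have "{H. max_subgraph connected H} = (\<lambda>i. G \<restriction> V i) ` c ` verts G"
  proof (intro set_eqI iffI)
    fix H assume "H \<in> {H. max_subgraph connected H}"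
    then have H: "max_subgraph connected H" by simp
    then obtain i where i: "i \<in> c ` verts G" "verts H \<subseteq> V i"
      using fibre unfolding max_subgraph_def by blast
    have "subgraph H G"
      using H by (simp add: max_subgraph_def)
    then have "subgraph H (G \<restriction> V i)"
      using i(2) wf_digraph.tail_in_verts[of H] wf_digraph.head_in_verts[of H]
        wellformed_induce_subgraph[of "V i"]
      unfolding subgraph_def compatible_def by fastforce
    then have "H = G \<restriction> V i"
      using H sub[of i] conn[OF i(1)] unfolding max_subgraph_def by metis
    then show "H \<in> (\<lambda>i. G \<restriction> V i) ` c ` verts G"
      using i by blast
  next
    fix H assume "H \<in> (\<lambda>i. G \<restriction> V i) ` c ` verts G"
    then obtain i where i: "i \<in> c ` verts G" "H = G \<restriction> V i"
      by blast
    have "max_subgraph connected (G \<restriction> V i)"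
      using sub conn[OF i(1)] maximal[OF _ _ _ i(1)] unfolding max_subgraph_def by blast
    then show "H \<in> {H. max_subgraph connected H}"
      using i by simp
  qed
  \<comment> \<open>Only labels that occur are considered, so the fibres are nonempty and determine
    their labels.\<close>
  moreover have "inj_on (\<lambda>i. G \<restriction> V i) (c ` verts G)"
  proof (rule inj_onI)
    fix i j assume i: "i \<in> c ` verts G" and "G \<restriction> V i = G \<restriction> V j"
    then have "V i = V j"
      by (metis induce_subgraph_verts)
    then show "i = j"
      using i by (auto simp: V_def)
  qed
  ultimately show ?thesis
    by (simp add: num_components_def card_image)
qed


section \<open>The cut lattice of a complete acyclic digraph\<close>

text \<open>The arcs, as pairs of positions, that jump over no threshold in \<open>S\<close>.\<close>

definition uncut_pairs :: "nat \<Rightarrow> nat set \<Rightarrow> (nat \<times> nat) set" where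
  "uncut_pairs n S = {(i, j). i < j \<and> j < n \<and> (\<forall>t\<in>S. \<not> (i < t \<and> t \<le> j))}"

context complete_acyclic_digraph
begin

text \<open>In-neighbours are counted so that positions can be compared through inclusion of sets of
  in-neighbours.\<close>

definition pos :: "'a \<Rightarrow> nat" where
  "pos v = card {u \<in> verts D. \<exists>e\<in>arcs D. tail D e = u \<and> head D e = v}"

text \<open>A threshold \<open>t\<close> stands for the gap between positions \<open>t - 1\<close>
  and \<open>t\<close>.\<close>

definition uncut :: "nat set \<Rightarrow> 'b set" where
  "uncut S = {e \<in> arcs D. \<forall>t\<in>S. \<not> (pos (tail D e) < t \<and> t \<le> pos (head D e))}"

text \<open>Completeness joins the two outer vertices by an arc, and the wrong orientation would
  close a directed triangle.\<close>

lemma arc_trans: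
  assumes e: "e1 \<in> arcs D" "e2 \<in> arcs D" "head D e1 = tail D e2"
  shows "\<exists>e\<in>arcs D. tail D e = tail D e1 \<and> head D e = head D e2"
proof -
  let ?u = "tail D e1" and ?v = "tail D e2" and ?w = "head D e2"
  have neq: "?u \<noteq> ?v" "?v \<noteq> ?w"
    using e no_loops by metis+
  \<comment> \<open>Two opposite arcs would join the same pair of vertices, for which completeness
    admits a single arc.\<close>
  have "?u \<noteq> ?w"
  proof
    assume "?u = ?w"
    then have "e1 = e2"
      using complete[of ?u ?v] e neq by (auto simp: insert_commute)
    then show False
      using e neq by simp
  qed
  then obtain e3 where e3: "e3 \<in> arcs D" "{tail D e3, head D e3} = {?u, ?w}"
    using complete[of ?u ?w] e by auto
  have "\<not> (tail D e3 = ?w \<and> head D e3 = ?u)"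
  proof
    assume "tail D e3 = ?w \<and> head D e3 = ?u"
    then have "cycle [e1, e2, e3]"
      using e e3 neq \<open>?u \<noteq> ?w\<close>
      by (auto simp: cycle_def awalk_def intro!: exI[of _ ?u])
    then show False
      using no_directed_cycle by blast
  qed
  then show ?thesis
    using e3 by (auto simp: doubleton_eq_iff)
qed

text \<open>By transitivity the in-neighbours of the tail are in-neighbours of the head, and the
  tail itself is one more.\<close>

lemma pos_less:
  assumes e: "e \<in> arcs D"
  shows "pos (tail D e) < pos (head D e)"
  unfolding pos_def
proof (rule psubset_card_mono)
  let ?I = "\<lambda>v. {u \<in> verts D. \<exists>e\<in>arcs D. tail D e = u \<and> head D e = v}"
  have "?I (tail D e) \<subseteq> ?I (head D e)"
    using arc_trans[OF _ e] by auto
  moreover have "tail D e \<in> ?I (head D e)" "tail D e \<notin> ?I (tail D e)"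
    using e no_loops by (simp, blast, simp, metis)
  ultimately show "?I (tail D e) \<subset> ?I (head D e)"
    by blast
qed simp

text \<open>Completeness provides an arc in one of the two directions, and positions increase along
  arcs.\<close>

lemma ex_arc_iff_pos_less:
  assumes "u \<in> verts D" "v \<in> verts D"
  shows "(\<exists>e\<in>arcs D. tail D e = u \<and> head D e = v) \<longleftrightarrow> pos u < pos v"
proof
  assume "pos u < pos v"
  then obtain e where e: "e \<in> arcs D" "{tail D e, head D e} = {u, v}"
    using complete[of u v] assms by auto
  then show "\<exists>e\<in>arcs D. tail D e = u \<and> head D e = v"
    using pos_less[of e] \<open>pos u < pos v\<close> by (auto simp: doubleton_eq_iff)
qed (use pos_less in auto)

lemma pos_eq_iff: "u \<in> verts D \<Longrightarrow> v \<in> verts D \<Longrightarrow> pos u = pos v \<longleftrightarrow> u = v"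
  using complete[of u v] pos_less by (metis doubleton_eq_iff less_irrefl)

text \<open>No vertex is its own in-neighbour, which bounds the positions; injectivity and counting
  then give surjectivity.\<close>

lemma pos_image: "pos ` verts D = {..<card (verts D)}"
proof (rule card_subset_eq)
  have "pos v < card (verts D)" if "v \<in> verts D" for v
  proof -
    have "v \<notin> {u \<in> verts D. \<exists>e\<in>arcs D. tail D e = u \<and> head D e = v}"
      using no_loops by simp metis
    then show ?thesis
      unfolding pos_def using that by (intro psubset_card_mono) (simp, blast)
  qed
  then show "pos ` verts D \<subseteq> {..<card (verts D)}"
    by auto
  show "card (pos ` verts D) = card {..<card (verts D)}"
    using pos_eq_iff by (simp add: card_image inj_on_def)
qed simp

lemma pos_lt: "v \<in> verts D \<Longrightarrow> pos v < card (verts D)"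
  using pos_image by auto

lemma ex_pos_eq: "i < card (verts D) \<Longrightarrow> \<exists>v\<in>verts D. pos v = i"
  using pos_image by (metis imageE lessThan_iff)

text \<open>Since no arc enters \<open>X\<close>, the set \<open>X\<close> is an initial segment in
  the order of positions, and \<open>t\<close> is its length. The bounds on \<open>t\<close> express
  that the cut is nonempty.\<close>

lemma directed_cut_iff:
  "directed_cut D C \<longleftrightarrow>
    (\<exists>t\<in>{1..<card (verts D)}. C = {e \<in> arcs D. pos (tail D e) < t \<and> t \<le> pos (head D e)})"
proof
  assume "directed_cut D C"
  then obtain X where X: "X \<subseteq> verts D" "C \<noteq> {}"
    and C: "C = {e \<in> arcs D. tail D e \<in> X \<and> head D e \<in> verts D - X}"
    and closed: "\<not> (\<exists>e \<in> arcs D. tail D e \<in> verts D - X \<and> head D e \<in> X)"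
    unfolding directed_cut_def by blast
  then obtain e where e: "e \<in> arcs D" "tail D e \<in> X" "head D e \<in> verts D - X"
    by blast
  \<comment> \<open>The threshold is the first position outside \<open>X\<close>; such a position
    exists because the head of \<open>e\<close> lies outside.\<close>
  define t where "t = (LEAST i. \<exists>v\<in>verts D - X. pos v = i)"
  have "\<exists>v\<in>verts D - X. pos v = t"
    unfolding t_def by (rule LeastI_ex) (use e in blast)
  then obtain w where w: "w \<in> verts D" "w \<notin> X" "pos w = t"
    by blast
  have X_iff: "v \<in> X \<longleftrightarrow> pos v < t" if v: "v \<in> verts D" for v
  proof
    assume "v \<in> X"
    then have "\<not> pos w < pos v"
      using ex_arc_iff_pos_less[of w v] w v closed by blast
    moreover have "pos w \<noteq> pos v"
      using pos_eq_iff w v \<open>v \<in> X\<close> by blast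
    ultimately show "pos v < t"
      using w by simp
  next
    assume "pos v < t"
    then show "v \<in> X"
      using not_less_Least[of "pos v" "\<lambda>i. \<exists>v\<in>verts D - X. pos v = i"] v
      unfolding t_def by blast
  qed
  have "t \<in> {1..<card (verts D)}"
    using X_iff[of "tail D e"] e pos_lt w by auto
  moreover have "C = {e \<in> arcs D. pos (tail D e) < t \<and> t \<le> pos (head D e)}"
    unfolding C using X_iff by (auto simp: not_less[symmetric])
  ultimately show "\<exists>t\<in>{1..<card (verts D)}.
      C = {e \<in> arcs D. pos (tail D e) < t \<and> t \<le> pos (head D e)}"
    by blast
next
  assume "\<exists>t\<in>{1..<card (verts D)}.
    C = {e \<in> arcs D. pos (tail D e) < t \<and> t \<le> pos (head D e)}"
  then obtain t where t: "1 \<le> t" "t < card (verts D)"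
    and C: "C = {e \<in> arcs D. pos (tail D e) < t \<and> t \<le> pos (head D e)}"
    by auto
  \<comment> \<open>The arc from position \<open>t - 1\<close> to position \<open>t\<close>
    witnesses that the cut is nonempty.\<close>
  obtain u v where "u \<in> verts D" "pos u = t - 1" "v \<in> verts D" "pos v = t"
    using ex_pos_eq t by (meson less_imp_diff_less)
  then have "C \<noteq> {}"
    using ex_arc_iff_pos_less[of u v] t unfolding C by fastforce
  moreover have "\<not> (\<exists>e\<in>arcs D. tail D e \<in> verts D - {v \<in> verts D. pos v < t} \<and>
      head D e \<in> {v \<in> verts D. pos v < t})"
    using pos_less by fastforce
  moreover have "C = {e \<in> arcs D. tail D e \<in> {v \<in> verts D. pos v < t} \<and>
      head D e \<in> verts D - {v \<in> verts D. pos v < t}}"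
    unfolding C by auto
  ultimately show "directed_cut D C"
    unfolding directed_cut_def by (intro conjI exI[of _ "{v \<in> verts D. pos v < t}"]) auto
qed

lemma cut_complements_eq: "cut_complements D = uncut ` Pow {1..<card (verts D)}"
proof -
  let ?cut = "\<lambda>t. {e \<in> arcs D. pos (tail D e) < t \<and> t \<le> pos (head D e)}"
  have uncut: "uncut S = arcs D - \<Union> (?cut ` S)" for S
    by (auto simp: uncut_def)
  have "(\<forall>C\<in>F. directed_cut D C) \<longleftrightarrow> F \<in> Pow (?cut ` {1..<card (verts D)})" for F
    unfolding directed_cut_iff by blast
  then have "cut_complements D = (\<lambda>F. arcs D - \<Union>F) ` Pow (?cut ` {1..<card (verts D)})"
    unfolding cut_complements_def by (simp only: setcompr_eq_image Collect_mem_eq)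
  \<comment> \<open>Every set of cuts is the image under \<open>?cut\<close> of a set of
    thresholds.\<close>
  also have "\<dots> = uncut ` Pow {1..<card (verts D)}"
    unfolding image_Pow_surj[OF refl, symmetric] image_image uncut ..
  finally show ?thesis .
qed

text \<open>The arc from position \<open>t - 1\<close> to position \<open>t\<close> jumps over no
  threshold but \<open>t\<close>, so it detects whether \<open>t\<close> has been chosen.\<close>

lemma uncut_subset_iff:
  assumes "S \<subseteq> {1..<card (verts D)}" "T \<subseteq> {1..<card (verts D)}"
  shows "uncut T \<subseteq> uncut S \<longleftrightarrow> S \<subseteq> T"
proof
  assume sub: "uncut T \<subseteq> uncut S"
  show "S \<subseteq> T"
  proof (rule ccontr)
    assume "\<not> S \<subseteq> T"
    then obtain t where t: "t \<in> S" "t \<notin> T" "1 \<le> t" "t < card (verts D)"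
      using assms by fastforce
    obtain u v where uv: "u \<in> verts D" "pos u = t - 1" "v \<in> verts D" "pos v = t"
      using ex_pos_eq t by (meson less_imp_diff_less)
    then obtain e where e: "e \<in> arcs D" "tail D e = u" "head D e = v"
      using ex_arc_iff_pos_less[of u v] t by auto
    have "s = t" if "t - 1 < s" "s \<le> t" for s
      using that by linarith
    then have "e \<in> uncut T"
      using e uv t by (auto simp: uncut_def)
    moreover have "e \<notin> uncut S"
      using e uv t by (auto simp: uncut_def)
    ultimately show False
      using sub by blast
  qed
qed (auto simp: uncut_def)

lemma inj_on_uncut: "inj_on uncut (Pow {1..<card (verts D)})"
  using uncut_subset_iff by (auto intro!: inj_onI)

lemma moebius_uncut:
  assumes "S \<subseteq> {1..<card (verts D)}"
  shows "moebius (cut_complements_order D) (arcs D) (uncut S) = (-1) ^ card S"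
proof -
  have "moebius (cut_complements_order D) (uncut {}) (uncut S) = (-1) ^ card S"
  proof (rule moebius_Boolean_lattice[OF _ Partial_order_cut_complements_order])
    show "Field (cut_complements_order D) = uncut ` Pow {1..<card (verts D)}"
      by (simp add: Field_cut_complements_order cut_complements_eq)
    show "(uncut S, uncut T) \<in> cut_complements_order D \<longleftrightarrow> S \<subseteq> T"
      if "S \<subseteq> {1..<card (verts D)}" "T \<subseteq> {1..<card (verts D)}" for S T
      using that by (auto simp: cut_complements_order_def cut_complements_eq uncut_subset_iff)
  qed (use assms in \<open>auto simp: finite_cut_complements_order\<close>)
  \<comment> \<open>With no threshold nothing is removed: \<open>uncut {}\<close> is
    \<open>arcs D\<close>, the least element of the order.\<close>
  then show ?thesis
    by (simp add: uncut_def)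
qed

text \<open>Positions are injective and there are no parallel arcs, so an arc is determined by the
  positions of its ends. The count thus depends only on the number of vertices and on
  \<open>S\<close>.\<close>

lemma card_uncut: "card (uncut S) = card (uncut_pairs (card (verts D)) S)"
proof (rule bij_betw_same_card[of "\<lambda>e. (pos (tail D e), pos (head D e))"], rule bij_betwI')
  fix e e' assume e: "e \<in> uncut S" "e' \<in> uncut S"
  show "(pos (tail D e), pos (head D e)) = (pos (tail D e'), pos (head D e')) \<longleftrightarrow> e = e'"
    using e pos_eq_iff no_multi_arcs[of e e'] by (auto simp: uncut_def arc_to_ends_def)
next
  fix e assume "e \<in> uncut S"
  then show "(pos (tail D e), pos (head D e)) \<in> uncut_pairs (card (verts D)) S"
    using pos_less pos_lt by (auto simp: uncut_def uncut_pairs_def)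
next
  fix p assume p: "p \<in> uncut_pairs (card (verts D)) S"
  then obtain u v where uv: "u \<in> verts D" "v \<in> verts D" "p = (pos u, pos v)" "pos u < pos v"
    using ex_pos_eq unfolding uncut_pairs_def
    by (smt (verit, best) case_prodE less_trans mem_Collect_eq)
  then obtain e where "e \<in> arcs D" "tail D e = u" "head D e = v"
    using ex_arc_iff_pos_less by blast
  then show "\<exists>e\<in>uncut S. p = (pos (tail D e), pos (head D e))"
    using uv p by (intro bexI[of _ e]) (auto simp: uncut_def uncut_pairs_def)
qed

text \<open>The component of a vertex is identified by the first position of its interval, which is \<open>0\<close>
  or the largest threshold that does not exceed its position.\<close>

lemma num_components_uncut:
  assumes S: "S \<subseteq> {1..<card (verts D)}" and "verts D \<noteq> {}"
  shows "num_components (D\<lparr>arcs := uncut S\<rparr>) = card S + 1"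
proof -
  let ?G = "D\<lparr>arcs := uncut S\<rparr>"
  define c where "c v = Max (insert 0 {t \<in> S. t \<le> pos v})" for v
  have fin: "finite S"
    using S finite_subset by blast
  have "num_components ?G = card (c ` verts ?G)"
  proof (rule num_components_eq_card_fibres)
    show "wf_digraph ?G"
      by unfold_locales (auto simp: uncut_def)
    show "c (tail ?G e) = c (head ?G e)" if "e \<in> arcs ?G" for e
    proof -
      \<comment> \<open>Positions increase along \<open>e\<close>, and no threshold lies between
        those of its ends.\<close>
      have "{t \<in> S. t \<le> pos (tail D e)} = {t \<in> S. t \<le> pos (head D e)}"
        using that pos_less[of e] by (fastforce simp: uncut_def)
      then show ?thesis
        by (simp add: c_def)
    qed
    have adj: "\<exists>e\<in>uncut S. tail D e = u \<and> head D e = v"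
      if uv: "u \<in> verts D" "v \<in> verts D" "pos u < pos v" "c u = c v" for u v
    proof -
      obtain e where e: "e \<in> arcs D" "tail D e = u" "head D e = v"
        using ex_arc_iff_pos_less uv by blast
      \<comment> \<open>A separating threshold \<open>t\<close> would give
        \<open>c u \<le> pos u < t \<le> c v\<close>.\<close>
      have "\<not> (pos u < t \<and> t \<le> pos v)" if "t \<in> S" for t
      proof
        assume t: "pos u < t \<and> t \<le> pos v"
        then have "t \<le> c v"
          unfolding c_def using that fin by (intro Max_ge) auto
        moreover have "c u \<le> pos u"
          unfolding c_def using fin by (subst Max_le_iff) auto
        ultimately show False
          using uv t by simp
      qed
      then show ?thesis
        using e by (auto simp: uncut_def)
    qed
    show "\<exists>e\<in>arcs ?G. {tail ?G e, head ?G e} = {u, v}"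
      if "u \<in> verts ?G" "v \<in> verts ?G" "u \<noteq> v" "c u = c v" for u v
      using that adj[of u v] adj[of v u] pos_eq_iff[of u v]
      by (auto simp: doubleton_eq_iff neq_iff)
  qed
  also have "c ` verts ?G = insert 0 S"
  proof (intro equalityI subsetI)
    fix t assume "t \<in> c ` verts ?G"
    then obtain v where "t = c v"
      by blast
    moreover have "c v \<in> insert 0 {t \<in> S. t \<le> pos v}"
      unfolding c_def using fin by (intro Max_in) auto
    ultimately show "t \<in> insert 0 S"
      by auto
  next
    fix t assume t: "t \<in> insert 0 S"
    have "t < card (verts D)"
      using t S assms(2) by (auto simp: card_gt_0_iff)
    then obtain v where v: "v \<in> verts D" "pos v = t"
      using ex_pos_eq by blast
    have "c v = t"
      unfolding c_def using t v fin by (intro Max_eqI) auto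
    then show "t \<in> c ` verts ?G"
      using v by auto
  qed
  \<comment> \<open>Thresholds start at \<open>1\<close>, so the first interval, labelled
    \<open>0\<close>, is counted in addition.\<close>
  also have "card (insert 0 S) = card S + 1"
    using S fin by (subst card_insert_disjoint) auto
  finally show ?thesis .
qed

lemma nl_flow_poly_eq:
  assumes "verts D \<noteq> {}"
  shows "nl_flow_poly D = (\<Sum>S\<in>Pow {1..<card (verts D)}.
    (-1) ^ card S *
      monom 1 (card (uncut_pairs (card (verts D)) S) - (card (verts D) - (card S + 1))))"
proof -
  have sgn: "monom ((-1) ^ k) e = (-1) ^ k * monom (1 :: int) e" for k e
    by (cases "even k") (auto simp: minus_monom)
  have "nl_flow_poly D = (\<Sum>S\<in>Pow {1..<card (verts D)}.
    monom (moebius (cut_complements_order D) (arcs D) (uncut S))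
      (card (uncut S) - rk D (uncut S)))"
    unfolding nl_flow_poly_def cut_complements_eq sum.reindex[OF inj_on_uncut] o_def ..
  also have "\<dots> = (\<Sum>S\<in>Pow {1..<card (verts D)}.
    (-1) ^ card S *
      monom 1 (card (uncut_pairs (card (verts D)) S) - (card (verts D) - (card S + 1))))"
    using assms
    by (intro sum.cong) (auto simp: moebius_uncut rk_def num_components_uncut card_uncut sgn)
  finally show ?thesis .
qed

end


section \<open>Threshold sets and compositions\<close>

text \<open>Passing from \<open>n\<close> to \<open>Suc n\<close> adds the \<open>n - m\<close>
  pairs with second component \<open>n\<close>. For \<open>n < m\<close> truncated subtraction makes
  both sides zero.\<close>

lemma card_pairs_less: "card {(i, j). m \<le> i \<and> i < j \<and> j < n} = (n - m) choose 2"
proof (induction n)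
  case (Suc n)
  have fin: "finite {(i, j). m \<le> i \<and> i < j \<and> j < n}"
    by (rule finite_subset[of _ "{..<n} \<times> {..<n}"]) auto
  have "{(i, j). m \<le> i \<and> i < j \<and> j < Suc n} =
      {(i, j). m \<le> i \<and> i < j \<and> j < n} \<union> (\<lambda>i. (i, n)) ` {m..<n}"
    by auto
  moreover have "{(i, j). m \<le> i \<and> i < j \<and> j < n} \<inter> (\<lambda>i. (i, n)) ` {m..<n} = {}"
    by auto
  ultimately have "card {(i, j). m \<le> i \<and> i < j \<and> j < Suc n} = ((n - m) choose 2) + (n - m)"
    using fin Suc.IH by (simp add: card_Un_disjoint card_image inj_on_def)
  also have "\<dots> = (Suc n - m) choose 2"
  proof (cases "m \<le> n")
    case True
    then show ?thesis
      by (simp add: Suc_diff_le numeral_2_eq_2)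
  qed simp
  finally show ?case .
qed simp

text \<open>This is the cycle rank of a tournament on \<open>k\<close> vertices, its number of arcs
  less its rank.\<close>

lemma choose_two_minus: "(k choose 2) - (k - 1) = (k - 1) choose 2"
  by (cases k) (simp_all add: numeral_2_eq_2)

lemma finite_uncut_pairs: "finite (uncut_pairs n S)"
  by (rule finite_subset[of _ "{..<n} \<times> {..<n}"]) (auto simp: uncut_pairs_def)

lemma card_uncut_pairs_empty: "card (uncut_pairs n {}) = n choose 2"
  using card_pairs_less[of 0 n] by (simp add: uncut_pairs_def)

text \<open>The largest threshold \<open>m\<close> splits off the last interval
  \<open>{m..<n}\<close>: an uncut pair lies entirely below \<open>m\<close> or entirely from
  \<open>m\<close> on.\<close>

lemma card_uncut_pairs_insert:
  assumes "S \<subseteq> {1..<m}" "m < n"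
  shows "card (uncut_pairs n (insert m S)) = card (uncut_pairs m S) + ((n - m) choose 2)"
proof -
  have "uncut_pairs n (insert m S) = uncut_pairs m S \<union> {(i, j). m \<le> i \<and> i < j \<and> j < n}"
    using assms by (force simp: uncut_pairs_def)
  moreover have "uncut_pairs m S \<inter> {(i, j). m \<le> i \<and> i < j \<and> j < n} = {}"
    by (auto simp: uncut_pairs_def)
  moreover have "finite {(i, j). m \<le> i \<and> i < j \<and> j < n}"
    by (rule finite_subset[of _ "{..<n} \<times> {..<n}"]) auto
  ultimately show ?thesis
    by (simp add: card_Un_disjoint finite_uncut_pairs card_pairs_less)
qed

text \<open>Consecutive positions not separated by a threshold give distinct pairs.\<close>

lemma card_uncut_pairs_ge:
  assumes "S \<subseteq> {1..<n}"
  shows "n - (card S + 1) \<le> card (uncut_pairs n S)"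
proof -
  have "(\<lambda>i. (i - 1, i)) ` ({1..<n} - S) \<subseteq> uncut_pairs n S"
  proof
    fix p assume "p \<in> (\<lambda>i. (i - 1, i)) ` ({1..<n} - S)"
    then obtain i where i: "p = (i - 1, i)" "1 \<le> i" "i < n" "i \<notin> S"
      by auto
    then have "t = i" if "i - 1 < t" "t \<le> i" for t
      using that by linarith
    then show "p \<in> uncut_pairs n S"
      using i by (auto simp: uncut_pairs_def)
  qed
  from card_mono[OF finite_uncut_pairs this]
  have "card ({1..<n} - S) \<le> card (uncut_pairs n S)"
    by (simp add: card_image inj_on_def)
  then show ?thesis
    using assms by (simp add: card_Diff_subset finite_subset)
qed

text \<open>Subsets are classified by their largest element \<open>m\<close>; this matches splitting
  off the last part of a composition.\<close>

lemma sum_card_Suc_subsets: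
  fixes f :: "nat set \<Rightarrow> 'c::comm_monoid_add"
  shows "(\<Sum>S | S \<subseteq> {1..<n} \<and> card S = Suc p. f S) =
    (\<Sum>m\<in>{1..<n}. \<Sum>S | S \<subseteq> {1..<m} \<and> card S = p. f (insert m S))"
proof -
  have "(\<Sum>S | S \<subseteq> {1..<n} \<and> card S = Suc p. f S) =
    (\<Sum>(m, S)\<in>Sigma {1..<n} (\<lambda>m. {S. S \<subseteq> {1..<m} \<and> card S = p}). f (insert m S))"
  proof (rule sum.reindex_bij_witness[where j = "\<lambda>S. (Max S, S - {Max S})"
        and i = "\<lambda>(m, S). insert m S"])
    fix S assume S: "S \<in> {S. S \<subseteq> {1..<n} \<and> card S = Suc p}"
    then have fin: "finite S" and ne: "S \<noteq> {}"
      using finite_subset by auto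
    have Max: "Max S \<in> S" "\<And>x. x \<in> S \<Longrightarrow> x \<le> Max S"
      using fin ne by auto
    show "(Max S, S - {Max S}) \<in> Sigma {1..<n} (\<lambda>m. {S. S \<subseteq> {1..<m} \<and> card S = p})"
    proof -
      have "x \<in> {1..<Max S}" if "x \<in> S - {Max S}" for x
        using that S Max(2)[of x] by (auto dest!: subsetD)
      moreover have "Max S \<in> {1..<n}"
        using S Max(1) by blast
      ultimately show ?thesis
        using S Max(1) by (simp add: card_Diff_singleton subset_iff)
    qed
    show "(case (Max S, S - {Max S}) of (m, S) \<Rightarrow> insert m S) = S"
      "(case (Max S, S - {Max S}) of (m, S) \<Rightarrow> f (insert m S)) = f S"
      using Max by (auto simp: insert_absorb)
  next
    fix x assume "x \<in> Sigma {1..<n} (\<lambda>m. {S. S \<subseteq> {1..<m} \<and> card S = p})"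
    then obtain m S where x: "x = (m, S)" "1 \<le> m" "m < n" "S \<subseteq> {1..<m}" "card S = p"
      by auto
    then have fin: "finite S" and "m \<notin> S"
      using finite_subset by auto
    have "Max (insert m S) = m"
    proof (rule Max_eqI)
      show "y \<le> m" if "y \<in> insert m S" for y
        using that x(4) by (auto dest!: subsetD)
    qed (use fin in auto)
    then show "(Max (case x of (m, S) \<Rightarrow> insert m S),
        (case x of (m, S) \<Rightarrow> insert m S) - {Max (case x of (m, S) \<Rightarrow> insert m S)}) = x"
      using x(1) \<open>m \<notin> S\<close> by simp
    have "{1..<m} \<subseteq> {1..<n}"
      using x(3) by simp
    then show "(case x of (m, S) \<Rightarrow> insert m S) \<in> {S. S \<subseteq> {1..<n} \<and> card S = Suc p}"
      using x fin \<open>m \<notin> S\<close> by auto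
  qed
  then show ?thesis
    by (simp add: sum.Sigma)
qed

lemma finite_compositions: "finite (compositions n p)"
proof (rule finite_subset)
  show "compositions n p \<subseteq> {ks. set ks \<subseteq> {..n} \<and> length ks = p}"
    by (auto simp: compositions_def member_le_sum_list)
qed (simp add: finite_lists_length_eq)

lemma compositions_one: "n \<ge> 1 \<Longrightarrow> compositions n (Suc 0) = {[n]}"
  by (auto simp: compositions_def length_Suc_conv)

text \<open>Compositions are classified by the sum \<open>m\<close> of all parts but the last, which
  determines the last part as \<open>n - m\<close>.\<close>

lemma sum_compositions_Suc:
  fixes f :: "nat list \<Rightarrow> 'c::comm_monoid_add"
  assumes "p \<ge> 1"
  shows "(\<Sum>ks\<in>compositions n (Suc p). f ks) =
    (\<Sum>m\<in>{1..<n}. \<Sum>ks\<in>compositions m p. f (ks @ [n - m]))"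
proof -
  have "(\<Sum>ks\<in>compositions n (Suc p). f ks) =
    (\<Sum>(m, ks)\<in>Sigma {1..<n} (\<lambda>m. compositions m p). f (ks @ [n - m]))"
  proof (rule sum.reindex_bij_witness[where j = "\<lambda>ks. (sum_list (butlast ks), butlast ks)"
        and i = "\<lambda>(m, ks). ks @ [n - m]"])
    fix ks assume ks: "ks \<in> compositions n (Suc p)"
    then obtain ls k where ls: "ks = ls @ [k]"
      by (cases ks rule: rev_cases) (auto simp: compositions_def)
    \<comment> \<open>As \<open>p \<ge> 1\<close>, at least one positive part remains, which keeps
      \<open>m\<close> away from \<open>0\<close>.\<close>
    moreover have "1 \<le> sum_list ls"
      using ks assms ls by (cases ls) (auto simp: compositions_def)
    ultimately show "(sum_list (butlast ks), butlast ks) \<in> Sigma {1..<n} (\<lambda>m. compositions m p)"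
      "(case (sum_list (butlast ks), butlast ks) of (m, ks) \<Rightarrow> ks @ [n - m]) = ks"
      "(case (sum_list (butlast ks), butlast ks) of (m, ks) \<Rightarrow> f (ks @ [n - m])) = f ks"
      using ks by (auto simp: compositions_def)
  qed (auto simp: compositions_def)
  then show ?thesis
    by (simp add: sum.Sigma finite_compositions)
qed

text \<open>Both sides satisfy the same recursion: the largest threshold \<open>m\<close>
  corresponds to the last part \<open>n - m\<close>. There is one part more than there are
  thresholds.\<close>

lemma sum_subsets_eq_sum_compositions:
  assumes "n \<ge> 1"
  shows "(\<Sum>S | S \<subseteq> {1..<n} \<and> card S = p. monom 1 (card (uncut_pairs n S) - (n - (card S + 1)))) =
    (\<Sum>ks\<in>compositions n (Suc p). \<Prod>i<Suc p. monom (1 :: int) ((ks ! i - 1) choose 2))"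
  using assms
proof (induction p arbitrary: n)
  case 0
  have "{S. S \<subseteq> {1..<n} \<and> card S = 0} = {{}}"
    using finite_subset by fastforce
  then show ?case
    using 0 choose_two_minus[of n] by (simp add: compositions_one card_uncut_pairs_empty)
next
  case (Suc p)
  have "(\<Sum>S | S \<subseteq> {1..<n} \<and> card S = Suc p.
      monom (1 :: int) (card (uncut_pairs n S) - (n - (card S + 1)))) =
    (\<Sum>m\<in>{1..<n}. \<Sum>S | S \<subseteq> {1..<m} \<and> card S = p.
      monom 1 (card (uncut_pairs n (insert m S)) - (n - (card (insert m S) + 1))))"
    by (rule sum_card_Suc_subsets)
  also have "\<dots> = (\<Sum>m\<in>{1..<n}. \<Sum>S | S \<subseteq> {1..<m} \<and> card S = p.
      monom 1 (card (uncut_pairs m S) - (m - (card S + 1))) * monom 1 ((n - m - 1) choose 2))"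
  proof (intro sum.cong refl)
    fix m S assume m: "m \<in> {1..<n}" and "S \<in> {S. S \<subseteq> {1..<m} \<and> card S = p}"
    then have S: "S \<subseteq> {1..<m}" "finite S" "m \<notin> S"
      using finite_subset by auto
    \<comment> \<open>Here \<open>a\<close> and \<open>b\<close> count the pairs below
      \<open>m\<close> and in the last interval, and \<open>k\<close> counts the thresholds below
      \<open>m\<close>. The side conditions exclude truncation, so the exponent is additive over the
      intervals.\<close>
    have arith: "(a + b) - (n - (k + 1 + 1)) = (a - (m - (k + 1))) + d"
      if "k + 1 \<le> m" "m < n" "n - m - 1 \<le> b" "m - (k + 1) \<le> a" "b - (n - m - 1) = d"
      for a b d k :: nat
      using that by arith
    have "card S + 1 \<le> m"
      using card_mono[OF _ S(1)] m by (simp, linarith)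
    moreover have "n - m - 1 \<le> (n - m) choose 2"
      by (cases "n - m") (simp_all add: numeral_2_eq_2)
    ultimately have "card (uncut_pairs n (insert m S)) - (n - (card (insert m S) + 1)) =
      (card (uncut_pairs m S) - (m - (card S + 1))) + ((n - m - 1) choose 2)"
      using arith[OF _ _ _ card_uncut_pairs_ge[OF S(1)] choose_two_minus[of "n - m"]]
        card_uncut_pairs_insert[OF S(1), of n] m S by simp
    then show "monom (1 :: int) (card (uncut_pairs n (insert m S)) - (n - (card (insert m S) + 1))) =
      monom 1 (card (uncut_pairs m S) - (m - (card S + 1))) * monom 1 ((n - m - 1) choose 2)"
      by (simp add: mult_monom)
  qed
  also have "\<dots> = (\<Sum>m\<in>{1..<n}. \<Sum>ks\<in>compositions m (Suc p).
      (\<Prod>i<Suc p. monom 1 ((ks ! i - 1) choose 2)) * monom 1 ((n - m - 1) choose 2))"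
    using Suc.IH by (simp add: sum_distrib_right[symmetric] del: prod.lessThan_Suc)
  also have "\<dots> = (\<Sum>m\<in>{1..<n}. \<Sum>ks\<in>compositions m (Suc p).
      \<Prod>i<Suc (Suc p). monom 1 (((ks @ [n - m]) ! i - 1) choose 2))"
  proof (intro sum.cong refl)
    fix m ks assume "ks \<in> compositions m (Suc p)"
    then have "length ks = Suc p"
      by (simp add: compositions_def)
    then show "(\<Prod>i<Suc p. monom (1 :: int) ((ks ! i - 1) choose 2)) * monom 1 ((n - m - 1) choose 2) =
      (\<Prod>i<Suc (Suc p). monom 1 (((ks @ [n - m]) ! i - 1) choose 2))"
      by (simp add: nth_append)
  qed
  also have "\<dots> = (\<Sum>ks\<in>compositions n (Suc (Suc p)).
      \<Prod>i<Suc (Suc p). monom 1 ((ks ! i - 1) choose 2))"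
    by (rule sum_compositions_Suc[symmetric]) simp
  finally show ?case .
qed

theorem theorem8:
  fixes D :: "('a, 'b) pre_digraph" and n :: nat
  assumes "complete_acyclic_digraph D"
    and "card (verts D) = n" and "n \<ge> 1"
  shows "nl_flow_poly D =
    (\<Sum>p = 1..n. (-1) ^ (p - 1) *
      (\<Sum>ks \<in> compositions n p. \<Prod>i<p. monom (1 :: int) ((ks ! i - 1) choose 2)))"
proof -
  interpret complete_acyclic_digraph D by fact
  let ?g = "\<lambda>S. monom (1 :: int) (card (uncut_pairs n S) - (n - (card S + 1)))"
  have "card ` Pow {1..<n} \<subseteq> {..<n}"
  proof
    fix k assume "k \<in> card ` Pow {1..<n}"
    then obtain S where "k = card S" "S \<subseteq> {1..<n}"
      by auto
    then show "k \<in> {..<n}"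
      using card_mono[of "{1..<n}" S] \<open>n \<ge> 1\<close> by simp
  qed
  \<comment> \<open>The threshold sets are grouped by cardinality, which is at most
    \<open>n - 1\<close>.\<close>
  then have "(\<Sum>S\<in>Pow {1..<n}. (-1) ^ card S * ?g S) =
    (\<Sum>p<n. \<Sum>S | S \<in> Pow {1..<n} \<and> card S = p. (-1) ^ card S * ?g S)"
    by (intro sum.group[symmetric]) auto
  moreover have "verts D \<noteq> {}"
    using assms by auto
  ultimately have "nl_flow_poly D =
      (\<Sum>p<n. \<Sum>S | S \<in> Pow {1..<n} \<and> card S = p. (-1) ^ card S * ?g S)"
    using nl_flow_poly_eq \<open>card (verts D) = n\<close> by simp
  also have "\<dots> = (\<Sum>p<n. (-1) ^ p * (\<Sum>S | S \<subseteq> {1..<n} \<and> card S = p. ?g S))"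
    by (simp add: sum_distrib_left)
  also have "\<dots> = (\<Sum>p<n. (-1) ^ p *
      (\<Sum>ks\<in>compositions n (Suc p). \<Prod>i<Suc p. monom 1 ((ks ! i - 1) choose 2)))"
    by (simp only: sum_subsets_eq_sum_compositions[OF \<open>n \<ge> 1\<close>])
  \<comment> \<open>Shifting the index from the number of thresholds to the number of parts turns
    the sign into \<open>(-1) ^ (p - 1)\<close>.\<close>
  finally show ?thesis
    by (simp add: sum.atLeast1_atMost_eq del: prod.lessThan_Suc)
qed

end
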